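(* Let $F$ be a field of characteristic zero, let $n\ge 1$ be an integer, and let $g_1,\dots,g_n:\mathbb{Z}\to F$ be additive and injective maps. Then the Lie algebra $W(g_p,n)$ has no nonzero ad-diagonalizable element with respect to its basis $B$.
   Context: Definition of $W(g_p,n)$. Let $F$ be a field of characteristic zero and $g_p:\mathbb{Z}\to F$ ($1\le p\le n$) additive maps. $W(g_p,n)$ is the Lie algebra over $F$ with basis $$B=\left\{\binom{a_1}{i_1}\cdots\binom{a_n}{i_n}_k \;:\; a_1,\dots,a_n,i_1,\dots,i_n\in\mathbb{Z},\ 1\le k\le n\right\}$$ (these are formal symbols, not binomial coefficients). Abbreviate the symbol $\binom{a_1}{i_1}\cdots\binom{a_n}{i_n}_k$ by $\binom{a}{i}_k$ with $a=(a_1,\dots,a_n)$, $i=(i_1,\dots,i_n)\in\mathbb{Z}^n$, and let $\varepsilon_k\in\mathbb{Z}^n$ be the $k$-th standard basis vector. The bracket is the bilinear extension of $$\left[\binom{a}{i}_k,\binom{b}{j}_l\right]=g_k(b_k)\binom{a+b}{i+j}_l+j_k\binom{a+b}{i+j-\varepsilon_k}_l-g_l(a_l)\binom{a+b}{i+j}_k-i_l\binom{a+b}{i+j-\varepsilon_l}_k ,$$ where the integers $j_k$, $i_l$ are regarded as elements of $F$. An element $l\in W(g_p,n)$ is ad-diagonalizable with respect to $B$ if for every $m\in B$ there is a scalar $\alpha(m)\in F$ with $[l,m]=\alpha(m)\,m$. *)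

theory Defs
  imports "HOL-Analysis.Finite_Cartesian_Product" "HOL-Library.Poly_Mapping"
begin

text \<open>
  The index set \<open>{1, ..., n}\<close> is rendered by a finite type \<open>'n\<close>, so \<open>n = CARD('n) \<ge> 1\<close>.
  A triple \<open>(a, i, k)\<close> stands for the formal symbol with upper row \<open>a\<close>, lower row \<open>i\<close> and
  subscript \<open>k\<close>; \<open>W(g_p, n)\<close> is, as a vector space, the free space over these symbols.
\<close>

type_synonym 'n W_symbol = "(int ^ 'n) \<times> (int ^ 'n) \<times> 'n"

type_synonym ('n, 'f) W = "'n W_symbol \<Rightarrow>\<^sub>0 'f"

definition W_scale :: "'f::field \<Rightarrow> ('n::finite, 'f) W \<Rightarrow> ('n, 'f) W" where
  "W_scale c x = Poly_Mapping.map (\<lambda>y. c * y) x"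

definition W_basis :: "('n::finite, 'f::field) W set" where
  "W_basis = range (\<lambda>s. Poly_Mapping.single s 1)"

fun W_symbol_bracket ::
    "('n::finite \<Rightarrow> int \<Rightarrow> 'f::field) \<Rightarrow> 'n W_symbol \<Rightarrow> 'n W_symbol \<Rightarrow> ('n, 'f) W" where
  "W_symbol_bracket g (a, i, k) (b, j, l) =
      Poly_Mapping.single (a + b, i + j, l) (g k (b $ k))
    + Poly_Mapping.single (a + b, i + j - axis k 1, l) (of_int (j $ k))
    - Poly_Mapping.single (a + b, i + j, k) (g l (a $ l))
    - Poly_Mapping.single (a + b, i + j - axis l 1, k) (of_int (i $ l))"

definition W_bracket ::
    "('n::finite \<Rightarrow> int \<Rightarrow> 'f::field) \<Rightarrow> ('n, 'f) W \<Rightarrow> ('n, 'f) W \<Rightarrow> ('n, 'f) W" where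
  "W_bracket g x y =
     (\<Sum>s\<in>Poly_Mapping.keys x. \<Sum>t\<in>Poly_Mapping.keys y.
        W_scale (Poly_Mapping.lookup x s * Poly_Mapping.lookup y t) (W_symbol_bracket g s t))"

definition ad_diagonalizable ::
    "('n::finite \<Rightarrow> int \<Rightarrow> 'f::field) \<Rightarrow> ('n, 'f) W \<Rightarrow> bool" where
  "ad_diagonalizable g x \<longleftrightarrow> (\<forall>m\<in>W_basis. \<exists>\<alpha>. W_bracket g x m = W_scale \<alpha> m)"


subsection \<open>Vector space and Lie algebra structure\<close>

lemma lookup_W_scale [simp]:
  "Poly_Mapping.lookup (W_scale c x) s = c * Poly_Mapping.lookup x s"
  by (simp add: W_scale_def Poly_Mapping.map.rep_eq when_def)

interpretation W: vector_space W_scale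
  by unfold_locales (auto intro!: poly_mapping_eqI simp: lookup_add algebra_simps)

lemma W_expand:
  "x = (\<Sum>s\<in>Poly_Mapping.keys x. W_scale (Poly_Mapping.lookup x s) (Poly_Mapping.single s 1))"
  by (rule poly_mapping_eqI) (auto simp: lookup_sum lookup_single when_def if_distrib in_keys_iff cong: if_cong)

lemma W_basis_spans: "W.span W_basis = (UNIV :: ('n::finite, 'f::field) W set)"
proof -
  have "x \<in> W.span W_basis" for x :: "('n, 'f) W"
    by (subst W_expand, intro W.span_sum W.span_scale W.span_base) (simp add: W_basis_def)
  then show ?thesis by auto
qed

lemma W_basis_independent: "\<not> W.dependent (W_basis :: ('n::finite, 'f::field) W set)"
proof (subst W.dependent_explicit, clarify)
  fix t and u :: "('n, 'f) W \<Rightarrow> 'f" and v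
  assume t: "finite t" "t \<subseteq> W_basis" "(\<Sum>v\<in>t. W_scale (u v) v) = 0" and v: "v \<in> t" "u v \<noteq> 0"
  from t v obtain s where s: "v = Poly_Mapping.single s 1" by (auto simp: W_basis_def)
  have *: "u w * Poly_Mapping.lookup w s = (if w = v then u v else 0)" if "w \<in> t" for w
  proof -
    from that t(2) obtain r where "w = Poly_Mapping.single r 1" by (auto simp: W_basis_def)
    moreover from this have "w = v \<Longrightarrow> r = s" using s by (metis keys_single singleton_inject zero_neq_one)
    ultimately show ?thesis using s by (cases "r = s") (auto simp: lookup_single when_def)
  qed
  have "Poly_Mapping.lookup (\<Sum>v\<in>t. W_scale (u v) v) s = (\<Sum>w\<in>t. if w = v then u v else 0)"
    by (simp add: lookup_sum * cong: sum.cong)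
  also have "\<dots> = u v" using t v by simp
  finally show False using t(3) v by simp
qed

lemma W_bracket_superset:
  assumes "finite A" "Poly_Mapping.keys x \<subseteq> A" "finite B" "Poly_Mapping.keys y \<subseteq> B"
  shows "W_bracket g x y =
    (\<Sum>s\<in>A. \<Sum>t\<in>B. W_scale (Poly_Mapping.lookup x s * Poly_Mapping.lookup y t) (W_symbol_bracket g s t))"
proof -
  have "W_bracket g x y = (\<Sum>s\<in>Poly_Mapping.keys x. \<Sum>t\<in>B.
      W_scale (Poly_Mapping.lookup x s * Poly_Mapping.lookup y t) (W_symbol_bracket g s t))"
    unfolding W_bracket_def using assms
    by (intro sum.cong refl sum.mono_neutral_left) (auto simp: in_keys_iff)
  also have "\<dots> = (\<Sum>s\<in>A. \<Sum>t\<in>B.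
      W_scale (Poly_Mapping.lookup x s * Poly_Mapping.lookup y t) (W_symbol_bracket g s t))"
    using assms by (intro sum.mono_neutral_left) (auto simp: in_keys_iff)
  finally show ?thesis .
qed

lemma W_bracket_single [simp]:
  "W_bracket g (Poly_Mapping.single s c) (Poly_Mapping.single t d) = W_scale (c * d) (W_symbol_bracket g s t)"
  by (subst W_bracket_superset[of "{s}" _ "{t}"]) auto

lemma W_bracket_add_left: "W_bracket g (x + y) z = W_bracket g x z + W_bracket g y z"
proof -
  let ?A = "Poly_Mapping.keys x \<union> Poly_Mapping.keys y"
  show ?thesis using keys_add[of x y]
    by (simp add: W_bracket_superset[of ?A _ "Poly_Mapping.keys z"] lookup_add
        algebra_simps W.scale_left_distrib sum.distrib)
qed

lemma W_bracket_add_right: "W_bracket g z (x + y) = W_bracket g z x + W_bracket g z y"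
proof -
  let ?A = "Poly_Mapping.keys x \<union> Poly_Mapping.keys y"
  show ?thesis using keys_add[of x y]
    by (simp add: W_bracket_superset[of "Poly_Mapping.keys z" _ ?A] lookup_add
        algebra_simps W.scale_left_distrib sum.distrib)
qed

lemma W_bracket_scale_left: "W_bracket g (W_scale c x) y = W_scale c (W_bracket g x y)"
  by (subst (1 2) W_bracket_superset[of "Poly_Mapping.keys x" _ "Poly_Mapping.keys y"])
     (auto simp: in_keys_iff W.scale_sum_right mult.assoc)

lemma W_bracket_scale_right: "W_bracket g y (W_scale c x) = W_scale c (W_bracket g y x)"
  by (subst (1 2) W_bracket_superset[of "Poly_Mapping.keys y" _ "Poly_Mapping.keys x"])
     (auto simp: in_keys_iff W.scale_sum_right ac_simps)

lemma W_symbol_bracket_swap: "W_symbol_bracket g s t = - W_symbol_bracket g t s"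
  by (cases s; cases t) (simp add: add.commute)

lemma W_bracket_swap: "W_bracket g x y = - W_bracket g y x"
proof -
  have "W_bracket g x y = (\<Sum>t\<in>Poly_Mapping.keys y. \<Sum>s\<in>Poly_Mapping.keys x.
        W_scale (Poly_Mapping.lookup x s * Poly_Mapping.lookup y t) (W_symbol_bracket g s t))"
    unfolding W_bracket_def by (rule sum.swap)
  also have "\<dots> = - W_bracket g y x"
    unfolding W_bracket_def
    by (subst W_symbol_bracket_swap) (simp add: W.scale_minus_right sum_negf mult.commute)
  finally show ?thesis .
qed

lemma W_bracket_self [simp]: "W_bracket g x x = (0 :: ('n::finite, 'f::field_char_0) W)"
proof (rule poly_mapping_eqI)
  fix s
  have "Poly_Mapping.lookup (W_bracket g x x) s = - Poly_Mapping.lookup (W_bracket g x x) s"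
    by (subst W_bracket_swap) simp
  then show "Poly_Mapping.lookup (W_bracket g x x) s = Poly_Mapping.lookup 0 s"
    by (simp add: eq_neg_iff_add_eq_0)
qed

lemma W_bracket_simps:
  "W_bracket g (x - y) z = W_bracket g x z - W_bracket g y z"
  "W_bracket g z (x - y) = W_bracket g z x - W_bracket g z y"
  "W_bracket g 0 z = 0" "W_bracket g z 0 = 0"
  using W_bracket_add_left[of g "x - y" y z] W_bracket_add_right[of g z "x - y" y]
  by (simp_all add: algebra_simps W_bracket_def)

lemma W_scale_single [simp]:
  "W_scale c (Poly_Mapping.single s d) = Poly_Mapping.single s (c * d)"
  by (rule poly_mapping_eqI) (auto simp: lookup_single when_def)

lemma W_jacobi_symbol:
  fixes g :: "'n::finite \<Rightarrow> int \<Rightarrow> 'f::field_char_0"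
  assumes "\<And>p. additive (g p)"
  defines "e \<equiv> \<lambda>s. Poly_Mapping.single s (1::'f)"
  shows "W_bracket g (e s) (W_bracket g (e t) (e u))
       + W_bracket g (e t) (W_bracket g (e u) (e s))
       + W_bracket g (e u) (W_bracket g (e s) (e t)) = 0"
proof -
  obtain a i k where s: "s = (a, i, k)" by (cases s)
  obtain b j l where t: "t = (b, j, l)" by (cases t)
  obtain c h m where u: "u = (c, h, m)" by (cases u)
  note add = additive.add[OF assms(1)]
  show ?thesis
    unfolding s t u e_def
    apply (simp add: W_bracket_simps W_bracket_add_left W_bracket_add_right W.scale_right_distrib W.scale_right_diff_distrib add)
    apply (cases "k = l"; cases "l = m"; cases "k = m")
    apply (simp_all add: axis_def algebra_simps add single_add single_diff single_uminus)
    done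
qed

theorem W_jacobi:
  fixes g :: "'n::finite \<Rightarrow> int \<Rightarrow> 'f::field_char_0"
  assumes "\<And>p. additive (g p)"
  shows "W_bracket g x (W_bracket g y z) + W_bracket g y (W_bracket g z x)
       + W_bracket g z (W_bracket g x y) = 0"
proof -
  define J where "J = (\<lambda>x y z. W_bracket g x (W_bracket g y z) + W_bracket g y (W_bracket g z x)
       + W_bracket g z (W_bracket g x y))"
  have rotate: "J x y z = J y z x" for x y z
    by (simp add: J_def ac_simps)
  have sub: "W.subspace {z. J x y z = 0}" for x y
  proof (rule W.subspaceI)
    show "z + z' \<in> {z. J x y z = 0}" if "z \<in> {z. J x y z = 0}" "z' \<in> {z. J x y z = 0}" for z z'
    proof -
      have "J x y (z + z') = J x y z + J x y z'"
        by (simp add: J_def W_bracket_add_left W_bracket_add_right ac_simps)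
      then show ?thesis using that by simp
    qed
    show "W_scale c z \<in> {z. J x y z = 0}" if "z \<in> {z. J x y z = 0}" for c z
    proof -
      have "J x y (W_scale c z) = W_scale c (J x y z)"
        by (simp add: J_def W_bracket_scale_left W_bracket_scale_right W.scale_right_distrib)
      then show ?thesis using that by simp
    qed
  qed (simp add: J_def W_bracket_simps)
  have extend: "J x y z = 0" if "\<And>m. m \<in> W_basis \<Longrightarrow> J x y m = 0" for x y z
  proof -
    have "W.span W_basis \<subseteq> {z. J x y z = 0}"
      using that by (intro W.span_minimal sub) auto
    then show ?thesis by (auto simp: W_basis_spans)
  qed
  have 1: "J x y z = 0" if "x \<in> W_basis" "y \<in> W_basis" "z \<in> W_basis" for x y z
    using that W_jacobi_symbol[OF assms] by (auto simp: J_def W_basis_def)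
  have 2: "J x y z = 0" if "x \<in> W_basis" "y \<in> W_basis" for x y z
    by (rule extend, rule 1[OF that])
  have 3: "J x y z = 0" if "y \<in> W_basis" for x y z
  proof -
    have "J y z m = 0" if "m \<in> W_basis" for m
      using 2[OF that \<open>y \<in> W_basis\<close>, of z] rotate[of m y z] by simp
    then show ?thesis using extend[of y z x] rotate[of x y z] by simp
  qed
  have "J x y m = 0" if "m \<in> W_basis" for m
    using 3[OF that, of y x] rotate[of x y m] by simp
  then have "J x y z = 0" by (rule extend)
  then show ?thesis by (simp add: J_def)
qed

end

theory Submission
  imports Defs
begin

text \<open>
  Read the symbol \<open>(a, i, k)\<close> as the vector field \<open>h \<partial>\<^sub>k\<close> with
  \<open>h = e\<^sup>a x\<^sup>i\<close>, where \<open>\<partial>\<^sub>k h = g\<^sub>k(a\<^sub>k) h + i\<^sub>k h / x\<^sub>k\<close>. An element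
  \<open>x = \<Sum> f\<^sub>k \<partial>\<^sub>k\<close> then satisfies \<open>[x, h \<partial>\<^sub>l] = x(h) \<partial>\<^sub>l - h \<partial>\<^sub>l(x)\<close>, and
  division by \<open>h\<close> turns the second part into \<open>\<partial>\<^sub>l(x)\<close>, which does not depend on \<open>h\<close>. Hence
  the comparison of an arbitrary \<open>h\<close> with \<open>h = 1\<close> isolates the logarithmic derivative
  \<open>x(h) / h = \<Sum> (g\<^sub>k(b\<^sub>k) + j\<^sub>k / x\<^sub>k) f\<^sub>k\<close> for \<open>h = e\<^sup>b x\<^sup>j\<close>; this is
  \<open>bracket_log_derivative\<close>.

  If \<open>x\<close> is ad-diagonalizable, this logarithmic derivative must be a constant for every \<open>h\<close>
  (\<open>ad_diagonalizable_log_derivative\<close>). The choice \<open>h = e\<^sup>b\<close> with \<open>b\<close> the \<open>k\<close>-th unit vector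
  shows that \<open>g\<^sub>k(1) f\<^sub>k\<close> is constant, so \<open>f\<^sub>k\<close> is, because \<open>g\<^sub>k(1) \<noteq> 0\<close>. The choice
  \<open>h = x\<^sub>k\<close> shows that \<open>f\<^sub>k / x\<^sub>k\<close> is constant as well. Both are possible only if
  \<open>f\<^sub>k = 0\<close>. The exponentials are essential: \<open>x\<^sub>k \<partial>\<^sub>k\<close> acts diagonally on all
  \<open>x\<^sup>j \<partial>\<^sub>l\<close>.
\<close>

text \<open>
  The bracket terms with subscript \<open>k\<close>, in which the first symbol is differentiated, depend on
  \<open>b\<close> and \<open>j\<close> only through the translation by \<open>(b, j)\<close>; they reach the coefficient in question
  only when \<open>k = l\<close>, and then cancel in the difference.
\<close>

lemma symbol_bracket_log_derivative:
  fixes g :: "'n::finite \<Rightarrow> int \<Rightarrow> 'f::field_char_0"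
  assumes "\<And>p. additive (g p)"
  shows "Poly_Mapping.lookup (W_symbol_bracket g (a', i', k) (b, j, l)) (a + b, i + j, l)
       - Poly_Mapping.lookup (W_symbol_bracket g (a', i', k) (0, 0, l)) (a, i, l)
       = (g k (b $ k) when a' = a \<and> i' = i) + (of_int (j $ k) when a' = a \<and> i' = i + axis k 1)"
proof -
  have shift: "i' + j - v = i + j \<longleftrightarrow> i' = i + v" "i' - v = i \<longleftrightarrow> i' = i + v" for v
    by (auto simp: algebra_simps)
  show ?thesis
    by (simp add: lookup_add lookup_minus lookup_single shift additive.zero[OF assms] when_def)
qed

lemma bracket_log_derivative:
  fixes g :: "'n::finite \<Rightarrow> int \<Rightarrow> 'f::field_char_0"
  assumes "\<And>p. additive (g p)"
  shows "Poly_Mapping.lookup (W_bracket g x (Poly_Mapping.single (b, j, l) 1)) (a + b, i + j, l)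
       - Poly_Mapping.lookup (W_bracket g x (Poly_Mapping.single (0, 0, l) 1)) (a, i, l)
       = (\<Sum>k\<in>UNIV. g k (b $ k) * Poly_Mapping.lookup x (a, i, k)
           + of_int (j $ k) * Poly_Mapping.lookup x (a, i + axis k 1, k))"
    (is "?L x = ?R x")
proof -
  have single: "?L (Poly_Mapping.single s c) = ?R (Poly_Mapping.single s c)" for s c
  proof -
    obtain a' i' k where s: "s = (a', i', k)" by (cases s)
    have "?L (Poly_Mapping.single s c)
        = c * ((g k (b $ k) when a' = a \<and> i' = i) + (of_int (j $ k) when a' = a \<and> i' = i + axis k 1))"
      by (simp add: s symbol_bracket_log_derivative[OF assms] flip: right_diff_distrib
          del: W_symbol_bracket.simps)
    also have "\<dots> = (\<Sum>m\<in>UNIV. if m = k then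
        c * ((g k (b $ k) when a' = a \<and> i' = i) + (of_int (j $ k) when a' = a \<and> i' = i + axis k 1)) else 0)"
      by simp
    also have "\<dots> = ?R (Poly_Mapping.single s c)"
      by (intro sum.cong) (auto simp: s lookup_single when_def algebra_simps)
    finally show ?thesis .
  qed
  have add: "?L (y + z) = ?R (y + z)" if "?L y = ?R y" "?L z = ?R z" for y z
  proof -
    have "?L (y + z) = ?L y + ?L z"
      by (simp add: W_bracket_add_left lookup_add)
    also have "\<dots> = ?R (y + z)"
      unfolding that by (simp add: lookup_add algebra_simps sum.distrib)
    finally show ?thesis .
  qed
  have "x \<in> W.span W_basis"
    by (simp add: W_basis_spans)
  then show ?thesis
  proof (induction rule: W.span_induct_alt)
    case base
    then show ?case by (simp add: W_bracket_simps)
  next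
    case (step c y z)
    then obtain s where "W_scale c y = Poly_Mapping.single s c"
      by (auto simp: W_basis_def)
    then have "?L (W_scale c y) = ?R (W_scale c y)"
      by (simp only: single)
    then show ?case using step.IH by (rule add)
  qed
qed

text \<open>
  Off \<open>(a, i) = (0, 0)\<close>, the two coefficients compared in the preceding lemma both lie outside
  the line spanned by the basis element that is being bracketed.
\<close>

lemma ad_diagonalizable_log_derivative:
  fixes g :: "'n::finite \<Rightarrow> int \<Rightarrow> 'f::field_char_0"
  assumes "\<And>p. additive (g p)" and "ad_diagonalizable g x" and "(a, i) \<noteq> (0, 0)"
  shows "(\<Sum>k\<in>UNIV. g k (b $ k) * Poly_Mapping.lookup x (a, i, k)
           + of_int (j $ k) * Poly_Mapping.lookup x (a, i + axis k 1, k)) = 0"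
proof -
  have vanish: "Poly_Mapping.lookup (W_bracket g x (Poly_Mapping.single t 1)) s = 0" if "t \<noteq> s" for s t
  proof -
    obtain \<alpha> where "W_bracket g x (Poly_Mapping.single t 1) = W_scale \<alpha> (Poly_Mapping.single t 1)"
      using assms(2) unfolding ad_diagonalizable_def W_basis_def by blast
    then show ?thesis using that by (simp add: lookup_single)
  qed
  have "(b, j, l) \<noteq> (a + b, i + j, l)" "(0, 0, l) \<noteq> (a, i, l)" for l :: 'n
    using assms(3) by auto
  \<comment> \<open>\<open>[x, h \<partial>\<^sub>l]\<close> detects \<open>x(h)\<close> equally well for every \<open>l\<close>, hence the arbitrary subscript.\<close>
  then show ?thesis
    unfolding bracket_log_derivative[OF assms(1), where l = undefined, symmetric]
    by (simp add: vanish)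
qed

theorem proposition1:
  fixes g :: "'n::finite \<Rightarrow> int \<Rightarrow> 'f::field_char_0"
  assumes "\<And>p. additive (g p)"
    and "\<And>p. inj (g p)"
  shows "\<not> (\<exists>x :: ('n, 'f) W. x \<noteq> 0 \<and> ad_diagonalizable g x)"
proof -
  have "x = 0" if diag: "ad_diagonalizable g x" for x :: "('n, 'f) W"
  proof (rule poly_mapping_eqI)
    fix s :: "'n W_symbol"
    obtain a i k where s: "s = (a, i, k)" by (cases s)
    note log_derivative = ad_diagonalizable_log_derivative[OF assms(1) diag]
    have g0: "g p 0 = 0" for p
      by (rule additive.zero[OF assms(1)])
    then have g1: "g k 1 \<noteq> 0"
      using injD[OF assms(2), of k 1 0] by auto
    have pick: "(\<Sum>m\<in>UNIV. g m (axis k 1 $ m) * f m) = g k 1 * f k"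
      "(\<Sum>m\<in>UNIV. of_int (axis k 1 $ m) * f m) = f k" for f :: "'n \<Rightarrow> 'f"
    proof -
      have "(\<Sum>m\<in>UNIV. g m (axis k 1 $ m) * f m) = (\<Sum>m\<in>UNIV. if m = k then g k 1 * f k else 0)"
        by (intro sum.cong) (auto simp: axis_def g0)
      then show "(\<Sum>m\<in>UNIV. g m (axis k 1 $ m) * f m) = g k 1 * f k" by simp
      have "(\<Sum>m\<in>UNIV. of_int (axis k 1 $ m) * f m) = (\<Sum>m\<in>UNIV. if m = k then f k else 0)"
        by (intro sum.cong) (auto simp: axis_def)
      then show "(\<Sum>m\<in>UNIV. of_int (axis k 1 $ m) * f m) = f k" by simp
    qed
    show "Poly_Mapping.lookup x s = Poly_Mapping.lookup 0 s"
    proof (cases "(a, i) = (0, 0)")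
      case False
      from log_derivative[OF False, of "axis k 1" 0] show ?thesis
        using g1 by (simp add: s pick)
    next
      case True
      \<comment> \<open>The constant term of \<open>f\<^sub>k\<close> appears in \<open>f\<^sub>k / x\<^sub>k\<close> at lower row minus the \<open>k\<close>-th unit vector.\<close>
      have "(0 :: int ^ 'n, - axis k 1 :: int ^ 'n) \<noteq> (0, 0)"
        by (simp add: axis_eq_0_iff)
      from log_derivative[OF this, of 0 "axis k 1"] show ?thesis
        using True by (simp add: s g0 pick)
    qed
  qed
  then show ?thesis by blast
qed

end
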